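(* The prime $p = 67$ is the unique prime $p < 2000$ with the following property: there is no irrational real number $\xi$ such that the simple continued fraction expansions of $\xi$ and of $p\xi$ both consist, from some point on, only of the terms $1$ and $2$. *)

theory Defs
  imports Complex_Main "HOL-Computational_Algebra.Primes"
begin

text \<open>Complete quotients of the simple continued fraction expansion of a real x:
  x_0 = x, x_(n+1) = 1 / frac x_n.  The n-th partial quotient is floor x_n.
  For irrational x, frac x_n is never 0, so this is the usual expansion.\<close>

primrec cf_rem :: "real \<Rightarrow> nat \<Rightarrow> real" where
  "cf_rem x 0 = x"
| "cf_rem x (Suc n) = 1 / frac (cf_rem x n)"

definition cf_term :: "real \<Rightarrow> nat \<Rightarrow> int" where
  "cf_term x n = \<lfloor>cf_rem x n\<rfloor>"

definition eventually_12 :: "real \<Rightarrow> bool" where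
  "eventually_12 x \<longleftrightarrow> (\<exists>N. \<forall>n\<ge>N. cf_term x n \<in> {1, 2})"

end

theory Submission
  imports Defs
begin

text \<open>Call \<open>x\<close> pure if all its partial quotients are 1 or 2. Complete quotients
  \<open>x\<close> of \<open>\<xi>\<close> and \<open>y\<close> of \<open>p \<xi>\<close> satisfy \<open>y = M x\<close> for an integer matrix \<open>M\<close>
  of determinant \<open>\<plusminus>p\<close>, acting as a Moebius transformation. Reading digits of \<open>x\<close>
  makes \<open>M\<close> nonnegative, and emitting digits of \<open>y\<close> as long as \<open>M\<close> remains nonnegative
  leads to one of finitely many matrices (Raney's transducer). Pure numbers lie between
  \<open>15/11\<close> and \<open>41/15\<close>, and for \<open>p = 67\<close> this bound refutes every run of the transducer
  after at most 17 further digits.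

  For the other primes, a cycle of the transducer gives a matrix \<open>N\<close> of determinant \<open>\<plusminus>p\<close>
  and words \<open>v\<close>, \<open>w\<close> in the digits 1 and 2 whose continued fraction matrices \<open>V\<close>, \<open>W\<close>
  satisfy \<open>N V = W N\<close>. Then \<open>N\<close> maps the positive fixed point \<open>y\<close> of \<open>V\<close> to that
  of \<open>W\<close>, and \<open>\<xi>\<close> is obtained by prepending finitely many digits to \<open>y\<close>.\<close>

section \<open>Matrices and their verification\<close>

type_synonym mat2 = "int \<times> int \<times> int \<times> int"

fun mat_mult :: "mat2 \<Rightarrow> mat2 \<Rightarrow> mat2" where
  "mat_mult (a, b, c, d) (e, f, g, h) = (a*e + b*g, a*f + b*h, c*e + d*g, c*f + d*h)"

primrec cf_mat :: "int list \<Rightarrow> mat2" where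
  "cf_mat [] = (1, 0, 0, 1)"
| "cf_mat (k # ks) = mat_mult (k, 1, 1, 0) (cf_mat ks)"

text \<open>\<open>M\<close> times the digit matrix \<open>(k, 1, 1, 0)\<close> on the right: the
  substitution \<open>x = k + 1 / x'\<close> in the argument.\<close>

fun read_in :: "int \<Rightarrow> mat2 \<Rightarrow> mat2" where
  "read_in k (a, b, c, d) = (a*k + b, a, c*k + d, c)"

text \<open>The inverse digit matrix times \<open>M\<close>: the substitution
  \<open>y = k + 1 / y'\<close> in the image.\<close>

fun emit :: "int \<Rightarrow> mat2 \<Rightarrow> mat2" where
  "emit k (a, b, c, d) = (c, d, a - k*c, b - k*d)"

fun values_at :: "int \<Rightarrow> int \<Rightarrow> mat2 \<Rightarrow> int \<times> int" where
  "values_at r s (a, b, c, d) = (a*r + b*s, c*r + d*s)"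

definition both :: "(int \<times> int \<Rightarrow> bool) \<Rightarrow> mat2 \<Rightarrow> bool" where
  "both P M \<longleftrightarrow> (if P (values_at 15 11 M) then P (values_at 41 15 M) else False)"

text \<open>The tests decide, from the images of the end points, whether \<open>M\<close> maps the interval from
  \<open>15/11\<close> to \<open>41/15\<close> to one side of itself, or else whether the next digit of the image is
  determined. Conditionals replace conjunctions so that rewriting evaluates them lazily.\<close>

primrec dead :: "nat \<Rightarrow> mat2 \<Rightarrow> bool" where
  "dead 0 M = False"
| "dead (Suc n) M =
     (if both (\<lambda>(u, v). 0 < v \<and> 11*u \<le> 15*v) M then True
      else if both (\<lambda>(u, v). 0 < v \<and> 41*v \<le> 15*u) M then True
      else if both (\<lambda>(u, v). 0 < v \<and> v < u \<and> u \<le> 2*v) M then dead n (emit 1 M)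
      else if both (\<lambda>(u, v). 0 < v \<and> 2*v < u) M then dead n (emit 2 M)
      else if dead n (read_in 1 M) then dead n (read_in 2 M) else False)"

text \<open>Enumerates the nonnegative matrices of determinant \<open>p = s d + t c\<close> whose
  columns lie strictly on different sides of \<open>k\<close>. Since \<open>c\<close> is
  nonnegative, \<open>s d \<le> p\<close>; since \<open>b\<close> is nonnegative,
  \<open>t \<le> k d\<close>. Swapping the columns covers determinant \<open>-p\<close>. As
  \<open>dead 0\<close> is false, fuel 18 allows 17 digits before the last test.\<close>

definition all_dead :: "int \<Rightarrow> int \<Rightarrow> int \<Rightarrow> bool" where
  "all_dead p k d = list_all (\<lambda>s. list_all (\<lambda>t.
       if (p - s*d) mod t = 0 then
         (let c = (p - s*d) div t; a = k*c + s; b = k*d - t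
          in dead 18 (a, b, c, d) \<and> dead 18 (b, a, d, c))
       else True) [1..k*d]) [1..p div d]"

text \<open>A certificate \<open>(p, j, q, v, w)\<close> describes \<open>\<xi> = [q; y]\<close> and \<open>p \<xi> = [j; x]\<close> with
  \<open>y\<close> and \<open>x\<close> purely periodic with periods \<open>v\<close> and \<open>w\<close>; the matrix \<open>(c, d, e, f)\<close>
  maps \<open>y\<close> to \<open>x\<close>. Its sign conditions exclude the negative fixed point of \<open>w\<close>.\<close>

definition cert_ok :: "int \<times> int \<times> int list \<times> int list \<times> int list \<Rightarrow> bool" where
  "cert_ok = (\<lambda>(p, j, q, v, w).
    (case cf_mat q of (a, b, c, d) \<Rightarrow>
       let e = p*a - j*c; f = p*b - j*d in
         1 \<le> j \<and> list_all (\<lambda>k. 1 \<le> k) q \<and> list_all (\<lambda>k. k = 1 \<or> k = 2) v \<and> v \<noteq> []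
         \<and> list_all (\<lambda>k. k = 1 \<or> k = 2) w \<and> w \<noteq> []
         \<and> 0 < c \<and> 0 < d \<and> 0 \<le> e \<and> 0 \<le> f \<and> 0 < e + f
         \<and> mat_mult (c, d, e, f) (cf_mat v) = mat_mult (cf_mat w) (c, d, e, f)))"

section \<open>Numbers with all partial quotients 1 or 2\<close>

definition pure_12 :: "real \<Rightarrow> bool" where
  "pure_12 x \<longleftrightarrow> (\<forall>n. cf_term x n \<in> {1, 2})"

lemma cf_rem_add: "cf_rem x (m + n) = cf_rem (cf_rem x m) n"
  by (induction n) auto

lemma eventually_12_iff: "eventually_12 x \<longleftrightarrow> (\<exists>N. pure_12 (cf_rem x N))"
proof -
  have "(\<forall>n\<ge>N. cf_term x n \<in> {1, 2}) \<longleftrightarrow> pure_12 (cf_rem x N)" for N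
    unfolding pure_12_def cf_term_def cf_rem_add [symmetric]
    by (metis le_add1 nat_le_iff_add)
  then show ?thesis
    unfolding eventually_12_def by blast
qed

lemma pure_12_cf_rem: "pure_12 x \<Longrightarrow> pure_12 (cf_rem x n)"
  by (simp add: pure_12_def cf_term_def cf_rem_add [symmetric])

lemma pure_12_range:
  assumes "pure_12 x"
  shows "1 \<le> x" "x < 3"
proof -
  have "\<lfloor>x\<rfloor> \<in> {1, 2}"
    using assms unfolding pure_12_def cf_term_def by (metis cf_rem.simps(1))
  then show "1 \<le> x" "x < 3"
    by (auto, linarith+)
qed

lemma pure_12_unfold:
  assumes "pure_12 x"
  obtains k :: int and x' where "k \<in> {1, 2}" "pure_12 x'" "x = k + 1 / x'"
proof -
  have "\<lfloor>x\<rfloor> \<in> {1, 2}"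
    using assms unfolding pure_12_def cf_term_def by (metis cf_rem.simps(1))
  moreover have "pure_12 (1 / frac x)"
    using pure_12_cf_rem [OF assms, of 1] by simp
  \<comment> \<open>By \<open>1 / 0 = 0\<close> this identity also covers
    \<open>frac x = 0\<close>.\<close>
  moreover have "x = \<lfloor>x\<rfloor> + 1 / (1 / frac x)"
    by (simp add: frac_def)
  ultimately show thesis
    using that by blast
qed

text \<open>Bounds \<open>u\<close> and \<open>v\<close> for all pure numbers improve to
  \<open>1 + 1/v\<close> and \<open>2 + 1/u\<close>. Four such steps from 1 and 3 give these
  fractions, close to the extreme values \<open>[1; 2, 1, 2, ...] = (1 + sqrt 3) / 2\<close> and
  \<open>[2; 1, 2, 1, ...] = 1 + sqrt 3\<close>.\<close>

lemma pure_12_bounds: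
  assumes "pure_12 x"
  shows "15/11 < x" "x < 41/15"
proof -
  have refine: "1 + 1 / v < y \<and> y < 2 + 1 / u"
    if b: "\<And>z. pure_12 z \<Longrightarrow> u < z \<and> z < v" and y: "pure_12 y" and u: "0 < u" for y u v
  proof -
    obtain k :: int and z where k: "k \<in> {1, 2}" "pure_12 z" "y = k + 1 / z"
      using pure_12_unfold [OF y] .
    have "1 / v < 1 / z" "1 / z < 1 / u"
      using b [OF k(2)] u by (auto simp: frac_less2)
    with k show ?thesis
      by auto
  qed
  have "1 < y \<and> y < 3" if y: "pure_12 y" for y
  proof -
    obtain k :: int and z where k: "k \<in> {1, 2}" "pure_12 z" "y = k + 1 / z"
      using pure_12_unfold [OF y] .
    have "0 < 1 / z"
      using pure_12_range [OF k(2)] by simp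
    with k pure_12_range [OF y] show ?thesis
      by (auto simp: add_pos_pos)
  qed
  from refine [OF this] have "4/3 < y \<and> y < 3" if "pure_12 y" for y
    using that by fastforce
  from refine [OF this] have "4/3 < y \<and> y < 11/4" if "pure_12 y" for y
    using that by fastforce
  from refine [OF this] have "15/11 < y \<and> y < 11/4" if "pure_12 y" for y
    using that by fastforce
  from refine [OF this assms] show "15/11 < x" "x < 41/15"
    by auto
qed

text \<open>Infinite descent on the denominator: the next complete quotient of \<open>a / b\<close>
  is \<open>b / c\<close> with \<open>0 < c < b\<close>.\<close>

lemma pure_12_irrational:
  assumes "pure_12 x"
  shows "x \<notin> \<rat>"
proof
  have "x \<noteq> of_int a / of_int b" if "0 < b" for a b
    using assms that
  proof (induction "nat b" arbitrary: a b x rule: less_induct)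
    case less
    obtain k :: int and y where k: "pure_12 y" "x = k + 1 / y"
      using pure_12_unfold [OF less.prems(1)] by metis
    have y: "1 < y"
      using pure_12_bounds(1) [OF k(1)] by simp
    show ?case
    proof
      assume x: "x = of_int a / of_int b"
      define c where "c = a - k * b"
      have "1 / y = of_int c / of_int b"
        using x k(2) less.prems(2) by (simp add: c_def field_simps)
      then have yc: "of_int b = y * of_int c"
        using y less.prems(2) by (simp add: field_simps)
      then have c: "0 < c"
        using y less.prems(2) by (metis of_int_0_less_iff zero_less_mult_pos order.strict_trans zero_less_one)
      have "of_int c < (of_int b :: real)"
        using yc y c by simp
      then have "nat c < nat b"
        using c by simp
      moreover have "y = of_int b / of_int c"
        using yc c by (simp add: field_simps)
      ultimately show False
        using less.hyps [OF _ k(1) c] by blast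
    qed
  qed
  moreover assume "x \<in> \<rat>"
  then obtain a b :: int where "0 < b" "x = of_int a / of_int b"
    by (metis Rats_cases')
  ultimately show False
    by blast
qed

lemma cf_rem_Rats_iff: "cf_rem x n \<in> \<rat> \<longleftrightarrow> x \<in> \<rat>"
proof (induction n)
  case (Suc n)
  let ?u = "cf_rem x n"
  have "1 / frac ?u \<in> \<rat> \<longleftrightarrow> frac ?u \<in> \<rat>"
    by (metis Rats_divide Rats_1 div_by_1 divide_divide_eq_right mult_1)
  also have "\<dots> \<longleftrightarrow> ?u \<in> \<rat>"
    unfolding frac_def by (metis Rats_add Rats_diff Rats_of_int diff_add_cancel)
  finally show ?case
    using Suc by simp
qed simp

text \<open>Keeps the fractional parts in both expansions nonzero, and shows that the numbers built
  from certificates are irrational.\<close>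

lemma eventually_12_irrational: "eventually_12 x \<Longrightarrow> x \<notin> \<rat>"
  using eventually_12_iff pure_12_irrational cf_rem_Rats_iff by blast

section \<open>Excluding a multiplier\<close>

text \<open>Cross-multiplied, so that no denominator has to be known to be nonzero
  beforehand.\<close>

fun mobius :: "mat2 \<Rightarrow> real \<Rightarrow> real \<Rightarrow> bool" where
  "mobius (a, b, c, d) x y \<longleftrightarrow> y * (of_int c * x + of_int d) = of_int a * x + of_int b"

fun mat_det :: "mat2 \<Rightarrow> int" where
  "mat_det (a, b, c, d) = a*d - b*c"

lemma mat_det_read_in: "mat_det (read_in k M) = - mat_det M"
  by (cases M) (simp add: algebra_simps)

lemma mat_det_emit: "mat_det (emit k M) = - mat_det M"
  by (cases M) (simp add: algebra_simps)

lemma mobius_read_in: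
  assumes "mobius M (of_int k + 1 / x) y" "x \<noteq> 0"
  shows "mobius (read_in k M) x y"
  using assms by (cases M) (simp add: field_simps)

lemma mobius_emit:
  assumes "mobius M x (of_int k + 1 / y)" "y \<noteq> 0"
  shows "mobius (emit k M) x y"
  using assms by (cases M) (simp add: field_simps)

text \<open>Each complete quotient of \<open>x\<close> reads one digit, which only changes the sign
  of the determinant; the digits may be arbitrary integers here.\<close>

lemma mobius_cf_rem:
  assumes "x \<notin> \<rat>" "mobius M x y"
  shows "\<exists>M'. \<bar>mat_det M'\<bar> = \<bar>mat_det M\<bar> \<and> mobius M' (cf_rem x n) y"
proof (induction n)
  case (Suc n)
  then obtain M' where M': "\<bar>mat_det M'\<bar> = \<bar>mat_det M\<bar>" "mobius M' (cf_rem x n) y"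
    by blast
  let ?u = "cf_rem x n"
  have "frac ?u \<noteq> 0"
    using assms(1) cf_rem_Rats_iff [of x n] by (metis Rats_of_int frac_eq_0_iff Ints_cases)
  moreover have "mobius M' (of_int \<lfloor>?u\<rfloor> + 1 / (1 / frac ?u)) y"
    using M'(2) by (simp add: frac_def)
  ultimately have "mobius (read_in \<lfloor>?u\<rfloor> M') (cf_rem x (Suc n)) y"
    using mobius_read_in by simp
  with M'(1) show ?case
    by (metis mat_det_read_in abs_minus_cancel)
qed (use assms(2) in \<open>simp only: cf_rem.simps, blast\<close>)

lemma cf_rem_mobius:
  assumes "y \<notin> \<rat>" "mobius M x y"
  shows "\<exists>M'. \<bar>mat_det M'\<bar> = \<bar>mat_det M\<bar> \<and> mobius M' x (cf_rem y n)"
proof (induction n)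
  case (Suc n)
  then obtain M' where M': "\<bar>mat_det M'\<bar> = \<bar>mat_det M\<bar>" "mobius M' x (cf_rem y n)"
    by blast
  let ?u = "cf_rem y n"
  have "frac ?u \<noteq> 0"
    using assms(1) cf_rem_Rats_iff [of y n] by (metis Rats_of_int frac_eq_0_iff Ints_cases)
  moreover have "mobius M' x (of_int \<lfloor>?u\<rfloor> + 1 / (1 / frac ?u))"
    using M'(2) by (simp add: frac_def)
  ultimately have "mobius (emit \<lfloor>?u\<rfloor> M') x (cf_rem y (Suc n))"
    using mobius_emit by simp
  with M'(1) show ?case
    by (metis mat_det_emit abs_minus_cancel)
qed (use assms(2) in \<open>simp only: cf_rem.simps, blast\<close>)

section \<open>Signs of linear forms on the interval, and soundness of the search\<close>

definition form :: "int \<Rightarrow> int \<Rightarrow> real \<Rightarrow> real" where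
  "form a b x = of_int a * x + of_int b"

text \<open>A linear form is a combination of its values at the end points, with weights that are
  positive inside the interval; \<open>226 = 41*11 - 15*15\<close>.\<close>

lemma form_interpolation:
  "226 * form a b x = (of_int (a*15 + b*11)) * (41 - 15 * x) + of_int (a*41 + b*15) * (11 * x - 15)"
  by (simp add: form_def algebra_simps)

lemma form_pos:
  assumes "0 < a*15 + b*11" "0 < a*41 + b*15" "pure_12 x"
  shows "0 < form a b x"
proof -
  have "0 < (of_int (a*15 + b*11) :: real)" "0 < (of_int (a*41 + b*15) :: real)"
    using assms(1,2) by (simp_all only: of_int_0_less_iff)
  moreover have "0 < 41 - 15 * x" "0 < 11 * x - 15"
    using pure_12_bounds [OF assms(3)] by simp_all
  ultimately have "0 < 226 * form a b x"
    unfolding form_interpolation by (intro add_pos_pos mult_pos_pos)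
  then show ?thesis by simp
qed

lemma form_nonneg:
  assumes "0 \<le> a*15 + b*11" "0 \<le> a*41 + b*15" "pure_12 x"
  shows "0 \<le> form a b x"
proof -
  have "0 \<le> (of_int (a*15 + b*11) :: real)" "0 \<le> (of_int (a*41 + b*15) :: real)"
    using assms(1,2) by (simp_all only: of_int_0_le_iff)
  moreover have "0 \<le> 41 - 15 * x" "0 \<le> 11 * x - 15"
    using pure_12_bounds [OF assms(3)] by simp_all
  ultimately have "0 \<le> 226 * form a b x"
    unfolding form_interpolation by (intro add_nonneg_nonneg mult_nonneg_nonneg)
  then show ?thesis by simp
qed

text \<open>The cases follow the branches of \<open>dead\<close>: the image violates a bound for
  pure numbers, or its next digit is forced and emitted, or the next digit of \<open>x\<close> is
  read in both possible ways.\<close>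

lemma dead_sound:
  assumes "dead n M" "pure_12 x" "pure_12 y"
  shows "\<not> mobius M x y"
  using assms
proof (induction n arbitrary: M x y)
  case (Suc n)
  obtain a b c d where M: "M = (a, b, c, d)"
    by (cases M)
  obtain k :: int and x' where k: "k \<in> {1, 2}" "pure_12 x'" "x = k + 1 / x'"
    using pure_12_unfold [OF Suc.prems(2)] .
  obtain l :: int and y' where l: "l \<in> {1, 2}" "pure_12 y'" "y = l + 1 / y'"
    using pure_12_unfold [OF Suc.prems(3)] .
  have y': "1 < y'" "x' \<noteq> 0"
    using pure_12_bounds [OF l(2)] pure_12_bounds [OF k(2)] by auto
  then have y'2: "0 < 1 / y'" "1 / y' < 1"
    by auto
  show ?case
  proof
    assume m: "mobius M x y"
    then have eq: "y * form c d x = form a b x"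
      by (simp add: M form_def)
    note both_def [simp] M [simp]
    consider
      (low) "both (\<lambda>(u, v). 0 < v \<and> 11*u \<le> 15*v) M"
    | (high) "both (\<lambda>(u, v). 0 < v \<and> 41*v \<le> 15*u) M"
    | (one) "both (\<lambda>(u, v). 0 < v \<and> v < u \<and> u \<le> 2*v) M" "dead n (emit 1 M)"
    | (two) "both (\<lambda>(u, v). 0 < v \<and> 2*v < u) M" "dead n (emit 2 M)"
    | (branch) "dead n (read_in 1 M)" "dead n (read_in 2 M)"
      using Suc.prems(1) by (auto simp del: both_def split: if_splits)
    then show False
    proof cases
      case low
      \<comment> \<open>The test says that these forms have the right sign at both end points, hence
        at \<open>x\<close>; the other cases use the same argument.\<close>
      then have "0 < form c d x" "0 \<le> form (15*c - 11*a) (15*d - 11*b) x"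
        using Suc.prems by (auto intro!: form_pos form_nonneg simp: algebra_simps split: if_splits)
      then have "0 < form c d x" "11 * y * form c d x \<le> 15 * form c d x"
        using eq by (auto simp: form_def algebra_simps)
      then show False
        using pure_12_bounds(1) [OF Suc.prems(3)] by simp
    next
      case high
      then have "0 < form c d x" "0 \<le> form (15*a - 41*c) (15*b - 41*d) x"
        using Suc.prems by (auto intro!: form_pos form_nonneg simp: algebra_simps split: if_splits)
      then have "0 < form c d x" "41 * form c d x \<le> 15 * y * form c d x"
        using eq by (auto simp: form_def algebra_simps)
      then show False
        using pure_12_bounds(2) [OF Suc.prems(3)] by simp
    next
      case one
      then have "0 < form c d x" "0 \<le> form (2*c - a) (2*d - b) x"
        using Suc.prems by (auto intro!: form_pos form_nonneg simp: algebra_simps split: if_splits)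
      then have "0 < form c d x" "y * form c d x \<le> 2 * form c d x"
        using eq by (auto simp: form_def algebra_simps)
      \<comment> \<open>Here \<open>y \<le> 2\<close>, while \<open>l = 2\<close> would give
        \<open>y > 2\<close> because \<open>1 / y'\<close> is positive.\<close>
      then have "l = 1"
        using l y'2 by auto
      then have "mobius (emit 1 M) x y'"
        using mobius_emit [of M x 1 y'] m l(3) y' by simp
      then show False
        using Suc.IH [OF one(2) Suc.prems(2) l(2)] by simp
    next
      case two
      then have "0 < form c d x" "0 < form (a - 2*c) (b - 2*d) x"
        using Suc.prems by (auto intro!: form_pos form_nonneg simp: algebra_simps split: if_splits)
      then have "0 < form c d x" "2 * form c d x < y * form c d x"
        using eq by (auto simp: form_def algebra_simps)
      then have "l = 2"
        using l y'2 by auto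
      then have "mobius (emit 2 M) x y'"
        using mobius_emit [of M x 2 y'] m l(3) y' by simp
      then show False
        using Suc.IH [OF two(2) Suc.prems(2) l(2)] by simp
    next
      case branch
      have "mobius (read_in k M) x' y"
        using m y'(2) unfolding k(3) by (rule mobius_read_in)
      then show False
        using Suc.IH [OF _ k(2) Suc.prems(3)] branch k(1) by blast
    qed
  qed
qed simp

section \<open>Reduction to nonnegative matrices\<close>

fun nonneg_mat :: "mat2 \<Rightarrow> bool" where
  "nonneg_mat (a, b, c, d) \<longleftrightarrow> 0 \<le> a \<and> 0 \<le> b \<and> 0 \<le> c \<and> 0 \<le> d"

text \<open>While the linear form \<open>a x + b\<close> is positive at \<open>x\<close> but has a negative coefficient,
  reading a digit of \<open>x\<close> decreases this number.\<close>

definition defect :: "int \<Rightarrow> int \<Rightarrow> nat" where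
  "defect a b = (if 0 \<le> a \<and> 0 \<le> b then 0 else nat (\<bar>a\<bar> + \<bar>b\<bar>))"

lemma form_read_in:
  assumes "x = of_int k + 1 / x'" "0 < x'"
  shows "form (a*k + b) a x' = x' * form a b x"
  using assms(2) unfolding assms(1) form_def by (simp add: field_simps)

lemma form_posD:
  assumes "0 < form a b x" "0 < x"
  shows "0 < a \<or> 0 < b"
proof (rule ccontr)
  assume "\<not> ?thesis"
  then have "form a b x \<le> 0"
    using assms(2) by (simp add: form_def add_nonpos_nonpos mult_nonpos_nonneg)
  with assms(1) show False by simp
qed

text \<open>Nonnegative pairs stay nonnegative. If \<open>a < 0 < b\<close>, positivity of the new
  form gives \<open>a k + b > 0\<close>, and the new sum of absolute values is
  \<open>a k + b - a \<le> b\<close>. If \<open>b < 0 < a\<close> and \<open>a k + b < 0\<close>, it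
  is \<open>a - a k - b \<le> -b\<close>. Both are below the old sum.\<close>

lemma defect_read_in:
  assumes "0 < form a b x" "x = of_int k + 1 / x'" "0 < x'" "1 \<le> k"
  shows "defect (a*k + b) a \<le> defect a b"
    and "0 < defect a b \<Longrightarrow> defect (a*k + b) a < defect a b"
proof -
  have "0 < x"
    using assms by (simp add: add_pos_pos)
  then have 1: "0 < a \<or> 0 < b"
    using form_posD assms(1) by blast
  have "0 < form (a*k + b) a x'"
    using form_read_in [OF assms(2,3)] assms(1,3) by simp
  then have 2: "0 < a*k + b \<or> 0 < a"
    using form_posD assms(3) by blast
  have 3: "a * k \<le> a" if "a < 0"
    using that assms(4) by simp
  have 4: "a \<le> a * k" if "0 \<le> a"
    using that assms(4) by (simp add: mult_le_cancel_left1)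
  \<comment> \<open>Hiding the product leaves a linear problem, in which facts 3 and 4 compare
    \<open>m\<close> with \<open>a\<close>.\<close>
  define m where "m = a * k"
  note 5 = 1 2 3 4 assms(4)
  show "defect (a*k + b) a \<le> defect a b"
    using 5 unfolding m_def [symmetric] by (auto simp: defect_def nat_le_iff abs_if)
  show "defect (a*k + b) a < defect a b" if "0 < defect a b"
    using that 5 unfolding m_def [symmetric] by (auto simp: defect_def nat_less_iff abs_if split: if_splits)
qed

text \<open>A zero denominator would make the numerator zero too, and eliminating \<open>x\<close>
  from the two leaves the determinant.\<close>

lemma mobius_form_nonzero:
  assumes "mobius (a, b, c, d) x y" "mat_det (a, b, c, d) \<noteq> 0"
  shows "form c d x \<noteq> 0"
proof
  assume 0: "form c d x = 0"
  then have "form a b x = 0"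
    using assms(1) by (simp add: form_def)
  then have "of_int a * form c d x - of_int c * form a b x = 0"
    using 0 by simp
  then have "of_int (mat_det (a, b, c, d)) = (0 :: real)"
    by (simp add: form_def algebra_simps)
  with assms(2) show False
    by (metis of_int_eq_0_iff)
qed

text \<open>Digits of \<open>x\<close> are read until both rows are nonnegative; the sum of the two
  row defects decreases, and both forms stay positive.\<close>

lemma nonneg_mobius_if_form_pos:
  assumes "pure_12 x" "mobius (a, b, c, d) x y" "0 < form a b x" "0 < form c d x"
  shows "\<exists>M x'. pure_12 x' \<and> mobius M x' y \<and> nonneg_mat M \<and> \<bar>mat_det M\<bar> = \<bar>mat_det (a, b, c, d)\<bar>"
  using assms
proof (induction "defect a b + defect c d" arbitrary: a b c d x rule: less_induct)
  case less
  show ?case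
  proof (cases "defect a b + defect c d = 0")
    case True
    then have "nonneg_mat (a, b, c, d)"
      by (auto simp: defect_def split: if_splits)
    with less.prems show ?thesis
      by blast
  next
    case False
    obtain k :: int and x' where k: "k \<in> {1, 2}" "pure_12 x'" "x = k + 1 / x'"
      using pure_12_unfold [OF less.prems(1)] .
    have x': "0 < x'"
      using pure_12_range [OF k(2)] by simp
    have "1 \<le> k"
      using k(1) by auto
    note d = defect_read_in [OF less.prems(3) k(3) x' this] defect_read_in [OF less.prems(4) k(3) x' this]
    have "defect (a*k + b) a + defect (c*k + d) c < defect a b + defect c d"
      using False d by linarith
    moreover have "mobius (a*k + b, a, c*k + d, c) x' y"
      using mobius_read_in [of "(a, b, c, d)" k x' y] less.prems(2) k(3) x' by simp
    moreover have "0 < form (a*k + b) a x'" "0 < form (c*k + d) c x'"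
      using form_read_in [OF k(3) x'] less.prems(3,4) x' by simp_all
    moreover have "\<bar>mat_det (a*k + b, a, c*k + d, c)\<bar> = \<bar>mat_det (a, b, c, d)\<bar>"
      using mat_det_read_in [of k "(a, b, c, d)"] by simp
    ultimately show ?thesis
      using less.hyps [OF _ k(2)] by metis
  qed
qed

text \<open>As \<open>y\<close> is positive, numerator and denominator have the same sign; if it is
  negative, the matrix is negated.\<close>

lemma nonneg_mobius:
  assumes "pure_12 x" "mobius M x y" "0 < y" "mat_det M \<noteq> 0"
  shows "\<exists>M' x'. pure_12 x' \<and> mobius M' x' y \<and> nonneg_mat M' \<and> \<bar>mat_det M'\<bar> = \<bar>mat_det M\<bar>"
proof -
  obtain a b c d where M: "M = (a, b, c, d)"
    by (cases M)
  have nz: "form c d x \<noteq> 0"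
    using mobius_form_nonzero assms M by blast
  have eq: "y * form c d x = form a b x"
    using assms(2) by (simp add: M form_def)
  show ?thesis
  proof (cases "0 < form c d x")
    case True
    then have "0 < form a b x"
      using eq assms(3) by (metis mult_pos_pos)
    with nonneg_mobius_if_form_pos assms(1,2) True M show ?thesis
      by blast
  next
    case False
    have neg: "form (- u) (- v) x = - form u v x" for u v
      by (simp add: form_def)
    have "0 < form (- c) (- d) x"
      using False nz by (simp add: neg)
    moreover from this have "0 < form (- a) (- b) x"
      using eq assms(3) by (metis mult_pos_pos neg mult_minus_right)
    moreover have "mobius (- a, - b, - c, - d) x y"
      using eq by (simp add: form_def algebra_simps)
    ultimately show ?thesis
      using nonneg_mobius_if_form_pos [OF assms(1), of "- a" "- b" "- c" "- d"] M by simp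
  qed
qed

text \<open>A nonnegative matrix from which the digit \<open>k\<close> cannot be emitted without leaving the nonnegative
  cone has columns on both sides of \<open>k\<close>. Writing its entries as \<open>a = k c + s\<close> and \<open>b = k d - t\<close>, the
  determinant becomes \<open>s d + t c\<close>, which leaves finitely many possibilities.\<close>

lemma all_dead_straddling:
  assumes dead: "\<And>d. d \<in> {1..p} \<Longrightarrow> all_dead p k d"
    and "0 \<le> b" "0 \<le> c" "k*c < a" "b < k*d" "a*d - b*c = p" "0 < k"
  shows "dead 18 (a, b, c, d) \<and> dead 18 (b, a, d, c)"
proof -
  define s t where "s = a - k*c" and "t = k*d - b"
  have pos: "1 \<le> s" "1 \<le> t" and "t \<le> k*d"
    using assms by (auto simp: s_def t_def)
  have d: "1 \<le> d"
    using assms by (smt (verit) mult_nonneg_nonpos)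
  have p: "p - s*d = t*c"
    using assms(6) by (simp add: s_def t_def algebra_simps)
  have "0 \<le> t*c"
    using pos assms(3) by simp
  then have sd: "s*d \<le> p"
    using p by simp
  then have "s \<le> p div d"
    using zdiv_mono1 [of "s*d" p d] d by simp
  moreover have "d \<le> p"
    using mult_right_mono [of 1 s d] sd pos d by linarith
  moreover have "(p - s*d) mod t = 0" "(p - s*d) div t = c"
    using p pos by auto
  moreover from calculation d have "all_dead p k d"
    by (intro dead) simp
  note this [unfolded all_dead_def list_all_iff Let_def, THEN bspec, THEN bspec, of s t]
  ultimately show ?thesis
    using pos \<open>t \<le> k*d\<close> by (simp add: s_def t_def)
qed

text \<open>Induction on the sum of the entries. Emitting the first digit \<open>k\<close> of
  \<open>y\<close> lowers it by \<open>k (c + d)\<close>; if that would leave the nonnegative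
  matrices, the columns straddle \<open>k\<close> and the finite search applies.\<close>

lemma no_pure_12_pair_nonneg:
  assumes dead: "\<And>k d. k \<in> {1, 2} \<Longrightarrow> d \<in> {1..p} \<Longrightarrow> all_dead p k d"
    and "0 < p" "pure_12 x" "pure_12 y" "mobius M x y" "nonneg_mat M" "\<bar>mat_det M\<bar> = p"
  shows False
  using assms(3-)
proof (induction "case M of (a, b, c, d) \<Rightarrow> nat (a + b + c + d)" arbitrary: M y rule: less_induct)
  case less
  obtain a b c d where M: "M = (a, b, c, d)"
    by (cases M)
  obtain k :: int and y' where k: "k \<in> {1, 2}" "pure_12 y'" "y = k + 1 / y'"
    using pure_12_unfold [OF less.prems(2)] .
  have y': "0 < y'" and x: "0 < x"
    using pure_12_range(1) k(2) less.prems(1) by fastforce+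
  have det: "\<bar>a*d - b*c\<bar> = p" and nn: "0 \<le> a" "0 \<le> b" "0 \<le> c" "0 \<le> d"
    using less.prems M by auto
  have "c \<noteq> 0 \<or> d \<noteq> 0"
    using det \<open>0 < p\<close> by auto
  then have cd: "0 < c + d"
    using nn by auto
  have "form c d x \<noteq> 0"
    using mobius_form_nonzero less.prems M \<open>0 < p\<close> by fastforce
  moreover have "0 \<le> form c d x"
    using nn x by (simp add: form_def)
  ultimately have "0 < form c d x"
    by simp
  moreover have "y' * form (a - k*c) (b - k*d) x = form c d x"
    using mobius_emit [of M x k y'] less.prems(3) k(3) y' by (simp add: M form_def)
  ultimately have "0 < form (a - k*c) (b - k*d) x"
    using y' by (metis zero_less_mult_pos)
  \<comment> \<open>Since \<open>y > k\<close>, the columns cannot both lie at or below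
    \<open>k\<close>.\<close>
  then have pos: "k*c < a \<or> k*d < b"
    using form_posD x by fastforce
  consider "k*c \<le> a" "k*d \<le> b" | "k*c < a" "b < k*d" | "a < k*c" "k*d < b"
    using pos by linarith
  then show False
  proof cases
    case 1
    have "nonneg_mat (emit k M)" "\<bar>mat_det (emit k M)\<bar> = p" "mobius (emit k M) x y'"
      using 1 nn less.prems(5) mobius_emit [of M x k y'] less.prems(3) k(3) y'
      unfolding mat_det_emit by (simp_all add: M)
    moreover have "(case emit k M of (a, b, c, d) \<Rightarrow> nat (a + b + c + d))
        < (case M of (a, b, c, d) \<Rightarrow> nat (a + b + c + d))"
      using cd nn k(1) 1 by (auto simp: M)
    ultimately show False
      using less.hyps less.prems(1) k(2) by blast
  next
    case 2
    \<comment> \<open>Comparison with \<open>k c d\<close> fixes the sign of the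
      determinant.\<close>
    have "b * c \<le> (k*d) * c" "(k*c) * d \<le> a * d"
      using 2 nn by (simp_all add: mult_right_mono)
    then have "a*d - b*c = p"
      using det by (simp add: algebra_simps)
    then have "dead 18 M"
      using all_dead_straddling [of p k b c a d] dead [OF k(1)] 2 nn k(1) M by auto
    with dead_sound less.prems show False
      by blast
  next
    case 3
    have "a * d \<le> (k*c) * d" "(k*d) * c \<le> b * c"
      using 3 nn by (simp_all add: mult_right_mono)
    then have "b*c - a*d = p"
      using det by (simp add: algebra_simps)
    \<comment> \<open>The straddling lemma is applied with the columns swapped, so its second
      conjunct concerns \<open>M\<close>.\<close>
    then have "dead 18 M"
      using all_dead_straddling [of p k a d b c] dead [OF k(1)] 3 nn k(1) M by auto
    with dead_sound less.prems show False
      by blast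
  qed
qed

text \<open>The diagonal matrix of \<open>p\<close> and 1 maps \<open>\<xi>\<close> to
  \<open>p \<xi>\<close>. Reading and emitting up to pure complete quotients preserves the absolute
  determinant \<open>p\<close>.\<close>

lemma no_eventually_12_multiple:
  assumes dead: "\<And>k d. k \<in> {1, 2} \<Longrightarrow> d \<in> {1..int p} \<Longrightarrow> all_dead (int p) k d"
    and "0 < p" "eventually_12 \<xi>" "eventually_12 (real p * \<xi>)"
  shows False
proof -
  obtain m n where mn: "pure_12 (cf_rem \<xi> m)" "pure_12 (cf_rem (real p * \<xi>) n)"
    using assms(3,4) eventually_12_iff by blast
  have "mobius (int p, 0, 0, 1) \<xi> (real p * \<xi>)"
    by simp
  with mobius_cf_rem [OF eventually_12_irrational [OF assms(3)], of _ _ m]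
  obtain M where M: "\<bar>mat_det M\<bar> = int p" "mobius M (cf_rem \<xi> m) (real p * \<xi>)"
    by (metis abs_of_nat mat_det.simps mult.right_neutral mult_zero_left diff_zero)
  with cf_rem_mobius [OF eventually_12_irrational [OF assms(4)], of M _ n]
  obtain N where N: "\<bar>mat_det N\<bar> = int p" "mobius N (cf_rem \<xi> m) (cf_rem (real p * \<xi>) n)"
    by metis
  have "0 < cf_rem (real p * \<xi>) n"
    using pure_12_range(1) [OF mn(2)] by simp
  with nonneg_mobius [OF mn(1) N(2)] N(1) \<open>0 < p\<close>
  obtain N' x' where "pure_12 x'" "mobius N' x' (cf_rem (real p * \<xi>) n)" "nonneg_mat N'"
    "\<bar>mat_det N'\<bar> = int p"
    by fastforce
  with no_pure_12_pair_nonneg [OF dead] mn(2) \<open>0 < p\<close> show False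
    by (metis of_nat_0_less_iff)
qed

section \<open>Periodic continued fractions and certificates\<close>

primrec cf_val :: "int list \<Rightarrow> real \<Rightarrow> real" where
  "cf_val [] z = z"
| "cf_val (k # ks) z = of_int k + 1 / cf_val ks z"

lemma cf_val_pos:
  assumes "0 < z" "\<forall>k\<in>set ks. 1 \<le> k"
  shows "0 < cf_val ks z"
  using assms by (induction ks) (auto intro!: add_pos_pos)

lemma cf_val_gt_1:
  assumes "0 < z" "\<forall>k\<in>set ks. 1 \<le> k" "1 < z \<or> ks \<noteq> []"
  shows "1 < cf_val ks z"
proof (cases ks)
  case (Cons k l)
  then have "1 \<le> real_of_int k" "0 < 1 / cf_val l z"
    using assms cf_val_pos [of z l] by auto
  then show ?thesis
    unfolding Cons cf_val.simps by linarith
qed (use assms in auto)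

lemma cf_rem_digit:
  assumes "1 < z"
  shows "cf_rem (of_int k + 1 / z) (Suc n) = cf_rem z n" "cf_term (of_int k + 1 / z) 0 = k"
    "cf_term (of_int k + 1 / z) (Suc n) = cf_term z n"
proof -
  have fl: "\<lfloor>of_int k + 1 / z\<rfloor> = k"
    using assms by (intro floor_unique) (auto simp: field_simps)
  then have "cf_rem (of_int k + 1 / z) 1 = z"
    by (simp add: frac_def)
  then show "cf_rem (of_int k + 1 / z) (Suc n) = cf_rem z n"
    using cf_rem_add [of _ 1 n] by simp
  then show "cf_term (of_int k + 1 / z) (Suc n) = cf_term z n"
    by (simp only: cf_term_def)
  show "cf_term (of_int k + 1 / z) 0 = k"
    using fl by (simp add: cf_term_def)
qed

lemma cf_rem_cf_val:
  assumes "1 < z" "\<forall>k\<in>set ks. 1 \<le> k"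
  shows "cf_rem (cf_val ks z) (length ks) = z"
  using assms(2)
proof (induction ks)
  case (Cons k ks)
  then have "1 < cf_val ks z"
    using cf_val_gt_1 [of z ks] assms(1) by simp
  then show ?case
    using Cons cf_rem_digit(1) by (simp del: cf_rem.simps)
qed simp

lemma eventually_12_cf_val:
  assumes "pure_12 z" "\<forall>k\<in>set ks. 1 \<le> k"
  shows "eventually_12 (cf_val ks z)"
proof -
  have "1 < z"
    using pure_12_bounds [OF assms(1)] by simp
  with cf_rem_cf_val assms show ?thesis
    unfolding eventually_12_iff by metis
qed

lemma pure_12_periodic:
  assumes "cf_val v z = z" "0 < z" "v \<noteq> []" "set v \<subseteq> {1, 2}"
  shows "pure_12 z"
proof -
  have z: "1 < z"
    using assms cf_val_gt_1 [of z v] by fastforce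
  \<comment> \<open>Generalised from \<open>v\<close> to all nonempty words, so that digits can be
    removed one at a time; when the word runs out, \<open>z = cf_val v z\<close> starts a new
    period.\<close>
  have "cf_term (cf_val ks z) n \<in> {1, 2}" if "ks \<noteq> []" "set ks \<subseteq> {1, 2}" for n ks
    using that
  proof (induction n arbitrary: ks)
    case 0
    then obtain k l where ks: "ks = k # l" "k \<in> {1, 2}" "set l \<subseteq> {1, 2}"
      by (cases ks) auto
    then have "1 < cf_val l z"
      using z by (intro cf_val_gt_1) auto
    then show ?case
      using ks cf_rem_digit(2) by simp
  next
    case (Suc n)
    then obtain k l where ks: "ks = k # l" "k \<in> {1, 2}" "set l \<subseteq> {1, 2}"
      by (cases ks) auto
    then have "1 < cf_val l z"
      using z by (intro cf_val_gt_1) auto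
    then have "cf_term (cf_val ks z) (Suc n) = cf_term (cf_val l z) n"
      using ks cf_rem_digit(3) by simp
    moreover have "cf_term (cf_val l z) n \<in> {1, 2}"
      using Suc.IH [of l] Suc.IH [of v] ks assms by (cases "l = []") auto
    ultimately show ?case
      by simp
  qed
  from this [OF assms(3,4)] show ?thesis
    unfolding pure_12_def assms(1) by blast
qed

lemma cf_val_mat:
  assumes "0 < z" "\<forall>k\<in>set ks. 1 \<le> k" "cf_mat ks = (a, b, c, d)"
  shows "0 < form a b z" "0 < form c d z" "cf_val ks z * form c d z = form a b z"
proof -
  have "0 < form a b z \<and> 0 < form c d z \<and> cf_val ks z * form c d z = form a b z"
    using assms(2,3)
  proof (induction ks arbitrary: a b c d)
    case (Cons k ks)
    obtain a' b' c' d' where m: "cf_mat ks = (a', b', c', d')"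
      by (cases "cf_mat ks")
    with Cons have IH: "0 < form a' b' z" "0 < form c' d' z"
      "cf_val ks z * form c' d' z = form a' b' z"
      by auto
    have top: "form a b z = of_int k * form a' b' z + form c' d' z" and c: "c = a'" "d = b'"
      using Cons.prems m by (auto simp: form_def algebra_simps)
    have "0 < of_int k * form a' b' z"
      using Cons.prems IH by simp
    then have "0 < form a b z"
      using top IH by linarith
    moreover have "cf_val ks z \<noteq> 0"
      using IH by auto
    then have "cf_val (k # ks) z * form c d z = form a b z"
      unfolding top c cf_val.simps by (simp add: distrib_right flip: IH(3))
    ultimately show ?case
      using c IH by simp
  qed (use assms(1) in \<open>auto simp: form_def\<close>)
  then show "0 < form a b z" "0 < form c d z" "cf_val ks z * form c d z = form a b z"
    by auto
qed

text \<open>The map is continuous from the interval \<open>{1..3}\<close> to itself, so the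
  intermediate value theorem gives a fixed point without solving a quadratic equation.\<close>

lemma cf_val_fixed_point:
  assumes "set v \<subseteq> {1, 2}"
  obtains z where "0 < z" "cf_val v z = z"
proof -
  have *: "continuous_on {1..3} (cf_val ks) \<and> (\<forall>z\<in>{1..3}. cf_val ks z \<in> {1..3})"
    if "set ks \<subseteq> {1, 2}" for ks
    using that
  proof (induction ks)
    case (Cons k ks)
    then have IH: "continuous_on {1..3} (cf_val ks)" "\<forall>z\<in>{1..3}. cf_val ks z \<in> {1..3}"
      by auto
    have "continuous_on {1..3} (\<lambda>z. of_int k + 1 / cf_val ks z)"
      using IH by (intro continuous_intros) fastforce+
    moreover have "of_int k + 1 / cf_val ks z \<in> {1..3}" if "z \<in> {1..3}" for z
    proof -
      have "1 \<le> cf_val ks z"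
        using IH(2) that by auto
      then have "0 \<le> 1 / cf_val ks z" "1 / cf_val ks z \<le> 1"
        by auto
      then show ?thesis
        using Cons.prems by auto
    qed
    moreover have "cf_val (k # ks) = (\<lambda>z. of_int k + 1 / cf_val ks z)"
      by (simp add: fun_eq_iff)
    ultimately show ?case
      by simp
  next
    case Nil
    have "cf_val [] = (\<lambda>z. z)"
      by (simp add: fun_eq_iff)
    then show ?case
      by simp
  qed
  then have "continuous_on {1..3} (\<lambda>z. cf_val v z - z)"
    "cf_val v 3 - 3 \<le> 0" "0 \<le> cf_val v 1 - 1"
    using assms by (auto intro!: continuous_intros)
  then obtain z where "1 \<le> z" "cf_val v z - z = 0"
    using IVT2' [of "\<lambda>z. cf_val v z - z" 3 0 1] by auto
  then show thesis
    by (intro that [of z]) auto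
qed

lemma cert_ok_sound:
  assumes "cert_ok (int p, j, q, v, w)"
  shows "\<exists>\<xi>. eventually_12 \<xi> \<and> eventually_12 (real p * \<xi>)"
proof -
  obtain a b c d where Q: "cf_mat q = (a, b, c, d)"
    by (cases "cf_mat q")
  obtain a1 b1 c1 d1 where V: "cf_mat v = (a1, b1, c1, d1)"
    by (cases "cf_mat v")
  obtain a2 b2 c2 d2 where W: "cf_mat w = (a2, b2, c2, d2)"
    by (cases "cf_mat w")
  \<comment> \<open>With \<open>\<xi> = (a y + b) / (c y + d)\<close>, the number
    \<open>p \<xi> - j\<close> equals \<open>(e y + f) / (c y + d)\<close>, and \<open>x\<close> is
    its reciprocal.\<close>
  define e f where "e = int p * a - j * c" and "f = int p * b - j * d"
  have j: "1 \<le> j" and q: "\<forall>k\<in>set q. 1 \<le> k" and v: "set v \<subseteq> {1, 2}" "v \<noteq> []"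
    and w: "set w \<subseteq> {1, 2}" "w \<noteq> []" and cd: "0 < c" "0 < d"
    and ef: "0 \<le> e" "0 \<le> f" "0 < e + f"
    and N: "mat_mult (c, d, e, f) (cf_mat v) = mat_mult (cf_mat w) (c, d, e, f)"
    using assms by (auto simp: cert_ok_def Q e_def f_def list_all_iff Let_def)
  have pos: "\<forall>k\<in>set v. 1 \<le> k" "\<forall>k\<in>set w. 1 \<le> k"
    using v w by auto
  obtain y where y: "0 < y" "cf_val v y = y"
    using cf_val_fixed_point [OF v(1)] .
  have NN: "a2*c + b2*e = c*a1 + d*c1" "a2*d + b2*f = c*b1 + d*d1"
    "c2*c + d2*e = e*a1 + f*c1" "c2*d + d2*f = e*b1 + f*d1"
    using N by (simp_all add: V W)
  \<comment> \<open>The vector \<open>(y, 1)\<close> is an eigenvector of \<open>V\<close> with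
    eigenvalue \<open>l\<close>. By \<open>N V = W N\<close>, its image under \<open>N\<close> is an
    eigenvector of \<open>W\<close> for the same \<open>l\<close>, and \<open>x\<close> is the ratio
    of its entries.\<close>
  define l x where "l = form c1 d1 y" and "x = form c d y / form e f y"
  have l: "0 < l" "form a1 b1 y = l * y"
    using cf_val_mat [OF y(1) pos(1) V] y(2) by (simp_all add: l_def mult.commute)
  have num: "0 < form c d y"
    using cd y(1) by (simp add: form_def add_pos_pos)
  have "0 < e \<or> 0 < f"
    using ef by linarith
  then have den: "0 < form e f y"
    using ef y(1) by (auto simp: form_def add_pos_nonneg add_nonneg_pos)
  have x: "0 < x" and xe: "form c d y = x * form e f y"
    using num den by (simp_all add: x_def)
  have "form a2 b2 x * form e f y = of_int a2 * form c d y + of_int b2 * form e f y"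
    by (simp add: xe form_def [of a2] algebra_simps)
  also have "\<dots> = of_int (a2*c + b2*e) * y + of_int (a2*d + b2*f)"
    by (simp add: form_def algebra_simps)
  also have "\<dots> = of_int c * form a1 b1 y + of_int d * form c1 d1 y"
    unfolding NN by (simp add: form_def algebra_simps)
  also have "\<dots> = l * form c d y"
    by (simp add: l(2) form_def [of c d] l_def [symmetric] algebra_simps)
  finally have top: "form a2 b2 x * form e f y = l * form c d y" .
  have "form c2 d2 x * form e f y = of_int c2 * form c d y + of_int d2 * form e f y"
    by (simp add: xe form_def [of c2] algebra_simps)
  also have "\<dots> = of_int (c2*c + d2*e) * y + of_int (c2*d + d2*f)"
    by (simp add: form_def algebra_simps)
  also have "\<dots> = of_int e * form a1 b1 y + of_int f * form c1 d1 y"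
    unfolding NN by (simp add: form_def algebra_simps)
  also have "\<dots> = l * form e f y"
    by (simp add: l(2) form_def [of e f] l_def [symmetric] algebra_simps)
  finally have bot: "form c2 d2 x = l"
    using den by simp
  have "cf_val w x * l = x * l"
    using cf_val_mat(3) [OF x pos(2) W] top bot den by (simp add: xe)
  then have "cf_val w x = x"
    using l by simp
  then have "pure_12 x" "pure_12 y"
    using pure_12_periodic x y v w by blast+
  then have "eventually_12 (cf_val q y)" "eventually_12 (cf_val [j] x)"
    using q j by (auto intro!: eventually_12_cf_val simp del: cf_val.simps)
  moreover have "real p * cf_val q y = cf_val [j] x"
  proof -
    have "real p * cf_val q y * form c d y = real p * form a b y"
      using cf_val_mat(3) [OF y(1) q Q] by (simp add: mult.assoc)
    also have "\<dots> = of_int j * form c d y + form e f y"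
      by (simp add: form_def e_def f_def algebra_simps)
    also have "\<dots> = cf_val [j] x * form c d y"
      using num den by (simp add: x_def distrib_right)
    finally show ?thesis
      using num by simp
  qed
  ultimately show ?thesis
    by metis
qed

section \<open>Certificates for the other primes below 2000\<close>

definition certs :: "(int \<times> int \<times> int list \<times> int list \<times> int list) list" where
  "certs = [
    (2,3,[1,1,2],[2],[2]), (3,5,[1,1,3],[1,2],[2,1]), (5,8,[1,1,2],[1],[1]),
     (7,12,[1,1,3],[2],[2]), (11,19,[1,1,3,1],[1],[1]), (13,22,[1,1,2,1,1],[2,1],[2,1]),
     (17,29,[1,1,2,1,2],[2],[2]), (19,24,[1,3,2],[1],[1]), (23,29,[1,3,1,1,2],[2],[2]),
     (29,53,[1,1,5],[1],[1]), (31,44,[1,2,3,1],[1],[1]), (37,60,[1,1,1,1,3],[1,2],[1,2]),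
     (41,59,[1,2,4],[2],[2]), (43,69,[1,1,1,1,1,1,1,1,2],[2,1,1,2],[1,1,2,2]),
     (47,55,[1,5,1,1,2],[2],[2]), (53,69,[1,3,4,2,1,1],[2,2,1,1],[2,2,1,1]),
     (59,85,[1,2,4,1],[1],[1]), (61,79,[1,3,3],[1],[1]), (71,80,[1,7,2],[1],[1]),
     (73,115,[1,1,1,2,1,1,2],[2],[2]), (79,150,[1,1,9],[2],[2]), (83,90,[1,11,3],[1,2],[2,1]),
     (89,169,[1,1,9,1],[1],[1]), (97,112,[1,6,3],[2],[2]), (101,180,[1,1,3,1,2],[1],[1]),
     (103,142,[1,2,1,1,1,1,2],[2],[2]), (107,170,[1,1,1,2,4,1],[2,1],[2,1]),
     (109,120,[1,9,2],[1],[1]), (113,176,[1,1,1,3,1,1,2],[2],[2]), (127,144,[1,7,3],[2],[2]),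
     (131,251,[1,1,11,1],[1],[1]), (137,244,[1,1,3,1,1,1,2],[2],[2]),
     (139,215,[1,1,1,4,2],[1],[1]), (149,258,[1,1,2,1,3,1],[1],[1]), (151,198,[1,3,5,2],[2],[2]),
     (157,272,[1,1,2,1,3,2],[1,2],[2,1]),
     (163,311,[1,1,10,2,2,1,2,1,2,1],[1,2,2,1,2,1,2,1],[1,2,1,2,2,1,1,2]),
     (167,181,[1,11,1,1,2],[2],[2]), (173,268,[1,1,1,4,2],[1,2,1,2,1],[2,1,1,2,1]),
     (179,284,[1,1,1,2,3,1],[1],[1]), (181,195,[1,12,2],[1],[1]), (191,326,[1,1,2,2,3],[2],[2]),
     (193,246,[1,3,1,1,1,1,2],[2],[2]), (197,373,[1,1,8,1,2,2,2,1,2],[2,2,2,1,2],[1,2,2,2,2]),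
     (199,220,[1,9,3],[2],[2]), (211,390,[1,1,5,1,2],[1],[1]), (223,432,[1,1,15,2],[2],[2]),
     (227,278,[1,4,2,1,1,2],[1,2],[1,2]), (229,311,[1,2,1,3,2],[1],[1]),
     (233,382,[1,1,1,1,3,1,2],[2],[2]), (239,380,[1,1,1,2,4,2],[2],[2]),
     (241,431,[1,1,3,1,3,1],[1],[1]), (251,369,[1,2,8,1],[1],[1]), (257,318,[1,4,5],[2],[2]),
     (263,374,[1,2,2,1,3,2],[2],[2]), (269,467,[1,1,2,1,4],[1],[1]), (271,526,[1,1,16],[1],[1]),
     (277,481,[1,1,2,1,4,2],[1,2],[2,1]), (281,414,[1,2,9],[2],[2]),
     (283,456,[1,1,1,1,1,2,3,1,1],[2,1,2,1,1],[1,2,1,2,1]),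
     (293,562,[1,1,11,1,1,2,2,1,1,2,1,1,1,2],[1,2,2,1,1,2,1,1,1,2],[1,2,1,1,2,2,1,2,1,1]),
     (307,325,[1,16,2,2,2,1,1],[1,1,2,2,1,1],[1,2,2,1,1,1]), (311,557,[1,1,3,1,4],[2],[2]),
     (313,507,[1,1,1,1,1,1,3,2],[2],[2]),
     (317,511,[1,1,1,1,1,2,3,1,2,1,1,1,1,1],[1,2,1,2,1,1,1,1,1],[1,1,1,1,1,2,1,2,1]),
     (331,448,[1,2,1,4,2],[1],[1]), (337,364,[1,12,3],[2],[2]), (347,395,[1,7,5,1],[2,1],[2,1]),
     (349,555,[1,1,1,2,4,1],[1],[1]), (353,521,[1,2,10],[2],[2]), (359,379,[1,17,1,1,2],[2],[2]),
     (367,447,[1,4,1,1,3],[2],[2]), (373,681,[1,1,4,1,3],[2,1],[2,1]),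
     (379,739,[1,1,19,1],[1],[1]), (383,521,[1,2,1,3,3],[2],[2]),
     (389,641,[1,1,1,1,5,1,1],[2,2,1],[2,2,1]), (397,775,[1,1,20,1],[2,1],[1,2]),
     (401,455,[1,7,2,1,2],[2],[2]), (409,507,[1,4,6,2],[2],[2]), (419,440,[1,19,2],[1],[1]),
     (421,769,[1,1,4,1,4,1],[2,1],[1,2]), (431,620,[1,2,3,1,1,1,2],[2],[2]),
     (433,640,[1,2,11,2],[2],[2]), (439,858,[1,1,21],[2],[2]), (443,529,[1,5,7],[1,2],[2,1]),
     (449,615,[1,2,1,2,3],[1],[1]), (457,835,[1,1,4,1,4],[2],[2]), (461,483,[1,20,2],[1],[1]),
     (463,480,[1,26,1,1,2,2,1,2],[2,2,2,1,2],[2,2,2,2,1]), (467,784,[1,1,2,8,3],[1,2],[2,1]),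
     (479,667,[1,2,1,1,5,2],[2],[2]), (487,884,[1,1,4,2,3],[2],[2]),
     (491,909,[1,1,5,1,3,1],[1],[1]), (499,774,[1,1,1,4,3],[1],[1]),
     (503,850,[1,1,2,4,3],[2],[2]), (509,631,[1,4,6],[1],[1]), (521,794,[1,1,1,9,1,1,2],[2],[2]),
     (523,551,[1,18,3],[2,1,1,2],[1,1,2,2]), (541,910,[1,1,2,6,2],[1],[1]),
     (547,812,[1,2,16,2],[2,2,1,2,2],[2,2,2,2,1]),
     (557,732,[1,3,5,1,2,2,2,1],[2,2,2,2,1],[2,2,1,2,2]), (563,685,[1,4,1,1,2],[2,1],[1,2]),
     (569,802,[1,2,2,3,2],[1],[1]), (571,869,[1,1,1,10,2],[1],[1]),
     (577,1017,[1,1,3,4,3],[1,2],[1,2]), (587,1133,[1,1,13,1,1],[2,1],[1,2]),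
     (593,736,[1,4,7,2],[2],[2]), (599,1174,[1,1,24,1],[1],[1]), (601,824,[1,2,1,2,4],[2],[2]),
     (607,802,[1,3,9],[2],[2]), (613,773,[1,3,1,4,1,1,1],[2,1],[2,1]),
     (617,914,[1,2,13],[2],[2]), (619,1209,[1,1,20,1,1],[1,2,2,1,1,1],[2,1,1,1,1,2]),
     (631,1153,[1,1,4,1,4,1],[1],[1]), (641,1004,[1,1,1,3,4],[1],[1]),
     (643,671,[1,22,1,1,1,2,2,2,2],[1,2,2,2,2],[2,2,2,1,2]), (647,770,[1,5,4,2],[1,2],[1,2]),
     (653,946,[1,2,4,2,3,2,1,2,1,1],[2,1,2,2,1,2,1,1],[2,2,1,2,1,1,2,1]),
     (659,860,[1,3,3,1,2],[1],[1]), (661,1291,[1,1,20,1,1,2],[1,2],[2,1]),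
     (673,957,[1,2,2,1,2,1,2],[2],[2]), (677,1028,[1,1,1,12,1,1],[1,2,1,1,2],[2,1,1,2,1]),
     (683,702,[1,35,3,1],[2,1],[2,1]), (691,1161,[1,1,2,7,2],[1],[1]),
     (701,1376,[1,1,26,1],[1],[1]), (709,880,[1,4,7,1],[1],[1]),
     (719,1115,[1,1,1,4,2,1,2],[2],[2]), (727,1428,[1,1,27,2],[2],[2]),
     (733,1340,[1,1,4,1,5],[1,2],[1,2]), (739,1382,[1,1,6,1,2,1,2,1,2],[2,1,2],[2,2,1]),
     (743,1065,[1,2,3,3,2,1],[2,1,1,1],[1,1,2,1]), (751,865,[1,6,1,1,3],[2],[2]),
     (757,1393,[1,1,5,3,1,1,1],[2,1],[2,1]), (761,1450,[1,1,9,1,1,1,2],[2],[2]),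
     (769,903,[1,5,1,2,1,1,2],[2],[2]),
     (773,1038,[1,2,1,10,2,2,2,1,2,1,2,1],[1,2,2,1,2,1,2,1],[2,2,1,1,2,1,2,1]),
     (787,1041,[1,3,10,1,2,2,2,2],[1,2,2,2,2],[2,2,2,1,2]),
     (797,1337,[1,1,2,9,2,2,2,1],[1,2,2,1],[2,2,1,1]), (809,1005,[1,4,8],[2],[2]),
     (811,1594,[1,1,28,1],[1],[1]), (821,1430,[1,1,2,1,7,1],[1],[1]),
     (823,1363,[1,1,1,1,10],[2],[2]),
     (827,1312,[1,1,1,2,2,1,2,1,1,1,2,1,1,1,1,2,1,2],[2,1,1,1,1,1,2,1,1,1,1,2,1,2],[1,1,1,1,2,2,1,2,1,1,1,1,2,1]),
     (829,1444,[1,1,2,1,7],[2,1],[2,1]), (839,1650,[1,1,29],[2],[2]),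
     (853,922,[1,12,3],[2,1],[2,1]), (857,961,[1,8,5],[2,2,2,1,2],[1,2,2,2,2]),
     (859,1442,[1,1,2,8,2],[1],[1]), (863,1115,[1,3,2,2,1,1,2],[2],[2]),
     (877,1439,[1,1,1,1,3,1,2,2],[1,2],[2,1]), (881,1208,[1,2,1,2,4,1],[1],[1]),
     (883,1193,[1,2,1,5,2,1,2,2],[1,1,2,2],[1,1,2,2]), (887,1090,[1,4,2,1,3,2],[2],[2]),
     (907,1341,[1,2,11,1,1,2,1,1,2],[1,2,1,1,2],[1,2,1,2,1]), (911,1647,[1,1,4,4,1,1,2],[2],[2]),
     (919,1522,[1,1,1,1,10],[1],[1]), (929,1170,[1,3,1,5,1,1,2],[2],[2]),
     (937,1019,[1,11,2,1,2],[2],[2]), (941,1169,[1,4,8],[1],[1]),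
     (947,1867,[1,1,34,1,1,2,1,2,1,1,1,1],[1,1,2,1,2,1,1,1,1],[2,1,1,1,1,1,1,2,1]),
     (953,1446,[1,1,1,13,1,1,2],[2],[2]),
     (967,1085,[1,8,6,1,1,1,1,2,1,1],[2,1,1,1,1,2,1,1],[1,1,1,2,1,1,2,1]),
     (971,1145,[1,5,1,1,3,1],[1],[1]),
     (977,1417,[1,2,4,1,1,1,1,2,1,2,2,1],[1,2,1,2,1,2,2,1],[1,2,1,1,2,2,1,2]),
     (983,1423,[1,2,4,3,3,1],[2,1],[2,1]), (991,1951,[1,1,31],[1],[1]),
     (997,1341,[1,2,1,8,3],[1,2],[1,2]), (1009,1449,[1,2,3,2,3],[2],[2]),
     (1013,1255,[1,4,5,1,1,2,1,2,2,1,1,2],[2,1,2,1,2,2,1,1,2],[2,1,1,2,2,1,2,1,2]),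
     (1019,1513,[1,2,16],[1],[1]), (1021,1548,[1,1,1,14,1,1,1,2],[1,2],[2,1]),
     (1031,1590,[1,1,1,5,2,1,2],[2],[2]), (1033,1684,[1,1,1,1,2,2,3],[1,2],[1,2]),
     (1039,1449,[1,2,1,1,7],[2],[2]), (1049,1304,[1,4,9,1],[1,2,1],[1,1,2]),
     (1051,1292,[1,4,2,1,4,1,2,2,2,1],[1,2,1,2,2,2,1],[2,1,1,2,2,2,1]),
     (1061,1663,[1,1,1,3,5],[1],[1]), (1063,1841,[1,1,2,1,2,1,3,2,1,1],[2,2,1,1],[2,1,1,2]),
     (1069,1863,[1,1,2,1,8],[1],[1]), (1087,2142,[1,1,33,2],[2],[2]),
     (1091,1971,[1,1,4,5,2],[1],[1]), (1093,2106,[1,1,12,1,3],[1,2],[1,2]),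
     (1097,1625,[1,2,13,2,1,2,1,1,1],[1,2,1,2,1,1,1],[1,2,1,1,1,1,2]),
     (1103,1426,[1,3,2,2,3],[2],[2]), (1109,1812,[1,1,1,1,2,1,3],[1],[1]),
     (1117,1772,[1,1,1,2,2,1,1,1,1,2],[1,2],[2,1]),
     (1123,1905,[1,1,2,3,2,1,2,2,2,1,1,1,1,1,1,2,1,2,1],[2,2,2,2,1,1,1,1,1,1,2,1,2,1],[2,1,2,1,2,1,1,1,1,1,1,2,2,2]),
     (1129,1894,[1,1,2,9,3,1],[2,1],[1,2]), (1151,1710,[1,2,17,1],[1],[1]),
     (1153,2273,[1,1,34],[1,2],[1,2]),
     (1163,2064,[1,1,3,2,4],[2,1,1,1,1,2,1,1],[1,1,2,1,1,2,1,1]),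
     (1171,2020,[1,1,2,1,1,1,4],[2,1,2],[1,2,2]), (1181,1715,[1,2,4,1,3,1],[1],[1]),
     (1187,1810,[1,1,1,9,2],[1,2,1,2,1],[1,1,2,1,2]), (1193,1501,[1,3,1,6,1,1,2],[2],[2]),
     (1201,1279,[1,15,3],[1],[1]), (1213,1838,[1,1,1,15,3],[1,2],[1,2]),
     (1217,1900,[1,1,1,3,1,1,3],[2,2,1,2,2],[2,1,2,2,2]), (1223,1259,[1,33,1,1,2],[2],[2]),
     (1229,1974,[1,1,1,1,1,5,2],[1],[1]), (1231,1501,[1,4,1,1,4],[1],[1]),
     (1237,1408,[1,7,4,1,1,2],[1,2],[2,1]), (1249,2094,[1,1,2,10,2],[1],[1]),
     (1259,2483,[1,1,35,1],[1],[1]), (1277,1465,[1,6,1,3,3,2,1,1],[2,2,1,1],[1,2,2,1]),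
     (1279,1959,[1,1,1,7,3],[1],[1]), (1283,1549,[1,4,1,4,3,1,1,2],[2,1,1,2],[1,2,2,1]),
     (1289,2484,[1,1,12,1,3,2],[2],[2]), (1291,1919,[1,2,18,1],[1],[1]),
     (1297,2385,[1,1,5,4,1,1,2],[2],[2]), (1301,1966,[1,1,1,21,3],[2,1,2],[2,2,1]),
     (1303,1406,[1,12,1,1,3,1],[1,2,1,2,1],[1,2,1,2,1]),
     (1307,1874,[1,2,3,3,3],[1,1,1,1,2,2],[1,1,1,2,2,1]), (1319,2239,[1,1,2,3,4,1],[1],[1]),
     (1321,2507,[1,1,8,1,4,2],[2],[2]), (1327,2289,[1,1,2,1,1,1,3,2,2,1],[1,2,2,1],[2,1,1,2]),
     (1361,2024,[1,2,19,2],[2],[2]), (1367,1405,[1,35,1,1,2],[2],[2]),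
     (1373,2277,[1,1,1,1,13],[1,1,2,2,1,1],[1,1,1,2,2,1]), (1381,1991,[1,2,3,1,4,1],[1],[1]),
     (1399,2075,[1,2,14,1,1],[1,2,1],[2,1,1]), (1409,1534,[1,11,4],[1],[1]),
     (1423,1825,[1,3,1,1,6],[2],[2]), (1427,2656,[1,1,6,4,3,2,1],[1,2,2,1],[1,2,2,1]),
     (1429,1976,[1,2,1,1,1,1,3,1],[1],[1]),
     (1433,2422,[1,1,2,4,3,2,1,2,1],[1,2,1,2,1],[1,2,1,1,2]), (1439,2140,[1,2,19],[1],[1]),
     (1447,1801,[1,4,12],[1,1,2,2],[1,2,2,1]), (1451,2620,[1,1,4,6,2],[1],[1]),
     (1453,2598,[1,1,3,1,2,1,1,1,1,2],[1,2],[2,1]), (1459,2752,[1,1,7,1,4],[1],[1]),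
     (1471,1774,[1,4,1,5,1,1,2],[2],[2]), (1481,2924,[1,1,38,1],[1],[1]),
     (1483,1627,[1,10,3,1,2,1,1,2],[2,1,1,2],[2,2,1,1]), (1487,2748,[1,1,5,1,1,2,3],[1,2],[2,1]),
     (1489,2298,[1,1,1,5,4],[1],[1]),
     (1493,2462,[1,1,1,1,5,1,3],[1,2,1,1,1,1,1,1,2],[1,1,1,2,1,2,1,1,1]),
     (1499,1708,[1,7,6],[1],[1]), (1511,2671,[1,1,3,3,4],[2],[2]),
     (1523,2304,[1,1,1,18,2,2,2,2,1,1,1,1,2,1,2,1],[1,2,2,2,1,1,1,1,2,1,2,1],[1,1,1,2,2,1,1,1,2,1,2,2]),
     (1531,1937,[1,3,1,3,3],[2,2,1],[2,2,1]),
     (1543,1586,[1,35,2,1,1,1,2,1,1],[1,1,1,1,2,1,1],[1,1,1,1,2,1,1]),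
     (1549,2079,[1,2,1,11,2],[1],[1]), (1553,2918,[1,1,7,3,1,1,2],[2],[2]),
     (1559,1599,[1,38,2],[1],[1]),
     (1567,3087,[1,1,32,1,1,1,1,2,2],[1,1,1,1,1,2,2],[2,1,1,1,1,1,2]),
     (1571,3041,[1,1,14,1,1,1,1],[1,2,2,1,2,1],[2,2,1,2,1,1]), (1579,2476,[1,1,1,3,6,1],[1],[1]),
     (1583,1816,[1,6,1,3,1,1,2],[2],[2]), (1597,2376,[1,2,20,2],[1,2],[2,1]),
     (1601,2617,[1,1,1,1,2,1,5,1],[1,2,1],[1,2,1]),
     (1607,2062,[1,3,1,1,8,1],[1,1,2,1],[1,1,2,1]), (1609,2245,[1,2,1,1,8],[1],[1]),
     (1613,1664,[1,31,2],[1,2,2,1],[2,2,1,1]), (1619,2333,[1,2,3,1,3,2],[1,2],[1,2]),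
     (1621,1966,[1,4,1,2,4,1],[2,1],[1,2]),
     (1627,2667,[1,1,1,1,3,2,2,2,2,2,1,2,1],[1,2,2,2,1,2,1],[2,1,2,1,1,2,2]),
     (1637,1701,[1,25,2,2],[2,2,2,1,2],[2,2,2,1,2]), (1657,2699,[1,1,1,1,2,3,3],[1,2],[1,2]),
     (1663,2232,[1,2,1,11,1,1,2],[2],[2]), (1667,2148,[1,3,2,6,3],[1,2],[2,1]),
     (1669,1805,[1,12,4,1],[1],[1]), (1693,3290,[1,1,16,1,2],[2,1],[2,1]),
     (1697,3286,[1,1,14,1,3,2],[2],[2]), (1699,2529,[1,2,21,1,2,2],[1,2,2],[2,1,2]),
     (1709,2310,[1,2,1,5,3],[1],[1]), (1721,2803,[1,1,1,1,2,3,1,1,2],[2],[2]),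
     (1723,2142,[1,4,9,2,2,1,1,1],[1,2,2,1,1,1],[1,1,1,1,2,2]),
     (1733,2832,[1,1,1,1,2,1,3,1,2,2,1,1],[2,2,1,1],[1,1,2,2]),
     (1741,3200,[1,1,5,5,3],[1,2],[1,2]), (1747,2481,[1,2,2,1,1,1,3],[2,1,2,2,2],[2,1,2,2,2]),
     (1753,3106,[1,1,3,2,1,1,2,2],[1,2],[2,1]), (1759,2695,[1,1,1,7,4,2],[2],[2]),
     (1777,2067,[1,6,8,2],[2],[2]), (1783,1942,[1,11,5,2],[2],[2]),
     (1787,2549,[1,2,2,1,9],[1,2],[2,1]), (1789,2789,[1,1,1,3,1,2,1,1,1,2,2],[1,2,2],[2,1,2]),
     (1801,3551,[1,1,34,1,2,1,1],[2,1,1],[1,1,2]), (1811,3514,[1,1,15,1,4,1],[2,1],[2,1]),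
     (1823,3079,[1,1,2,4,1,1,2,1],[2,1,1,1],[1,1,2,1]), (1831,3067,[1,1,2,12,1,1,2],[2],[2]),
     (1847,3652,[1,1,43,2],[2],[2]), (1861,2225,[1,5,9,1],[1],[1]),
     (1867,2860,[1,1,1,7,3,1,2,1,1,2,1,1],[1,1,2,1,1,2,1,1],[1,1,2,1,1,1,1,2]),
     (1871,3707,[1,1,53,1],[1,2,1],[1,2,1]), (1873,3544,[1,1,8,3,3,1],[2,1],[1,2]),
     (1877,2206,[1,5,1,2,3,1,1,2,2],[1,1,1,1,2,2],[1,1,2,2,1,1]),
     (1879,2127,[1,7,1,1,3,2,2],[1,2,2],[2,2,1]), (1889,2005,[1,16,4,2],[2],[2]),
     (1901,1999,[1,19,3],[1],[1]), (1907,2141,[1,8,7],[2,2,2,1,2],[2,2,1,2,2]),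
     (1913,2769,[1,2,4,3,1,1,2,2,1,2],[2,2,2,1,2],[2,2,1,2,2]), (1931,2919,[1,1,1,20,2],[1],[1]),
     (1933,3823,[1,1,44,1],[2,1],[1,2]), (1949,3110,[1,1,1,2,9,1],[1],[1]),
     (1951,3386,[1,1,2,1,3,1,1,1,2],[2],[2]),
     (1973,3054,[1,1,1,4,1,2,3,2,1,1],[2,2,1,1],[2,2,1,1]), (1979,3914,[1,1,44,1],[1],[1]),
     (1987,2433,[1,4,2,4,2,1,1,2,1,1],[2,1,1,1,1,2,1,1],[1,1,1,2,1,1,2,1]),
     (1993,3500,[1,1,3,9,1,1,2],[2],[2]),
     (1997,3636,[1,1,4,1,1,2,2,1,2,1,2,1,1],[1,1,2,1,2,1,1],[1,1,2,1,2,1,1]),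
     (1999,3408,[1,1,2,2,1,1,4,1,1],[2,1,1],[1,2,1])]"

lemma certs_ok: "list_all cert_ok certs"
  by code_simp

text \<open>Trial division by the primes up to 43, which is conclusive below
  \<open>47^2 = 2209\<close>.\<close>

definition no_small_factor :: "int \<Rightarrow> bool" where
  "no_small_factor n \<longleftrightarrow>
    (if n < 2 then False
     else \<not> list_ex (\<lambda>q. n \<noteq> q \<and> n mod q = 0)
       [2, 3, 5, 7, 11, 13, 17, 19, 23, 29, 31, 37, 41, 43])"

text \<open>Completeness of the table: forty blocks of fifty cover 0 to 1999, and short intervals
  suit evaluation by rewriting.\<close>

lemma fst_certs:
  "concat (map (\<lambda>c. filter (\<lambda>n. if no_small_factor n then n \<noteq> 67 else False)
     [50*c..50*c + 49]) [0..39]) = map fst certs"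
  by code_simp

lemma prime_below_2000_cert:
  assumes "prime p" "p < 2000" "p \<noteq> 67"
  shows "\<exists>j q v w. cert_ok (int p, j, q, v, w)"
proof -
  have "int p = q" if "1 < q" "int p mod q = 0" for q
  proof -
    have "prime (int p)" "0 \<le> q" "q dvd int p"
      using assms(1) that by auto
    then have "q = 1 \<or> q = int p"
      unfolding prime_int_iff by blast
    with that show ?thesis
      by simp
  qed
  then have no_factor: "\<not> list_ex (\<lambda>q. int p \<noteq> q \<and> int p mod q = 0) qs"
    if "list_all (\<lambda>q. 1 < q) qs" for qs
    using that unfolding list_ex_iff list_all_iff by metis
  have "\<not> int p < 2"
    using prime_ge_2_nat [OF assms(1)] by simp
  then have "no_small_factor (int p)"
    unfolding no_small_factor_def by (simp only: if_False, intro no_factor) simp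
  moreover define c where "c = int p div 50"
  have "int p < 2000" "0 \<le> int p"
    using assms(2) by simp_all
  then have "0 \<le> c" "c \<le> 39" "50*c \<le> int p" "int p \<le> 50*c + 49"
    unfolding c_def by presburger+
  ultimately have "\<exists>c\<in>{0..39}. int p \<in> {n \<in> {50*c..50*c + 49}.
      if no_small_factor n then n \<noteq> 67 else False}"
    using assms(3) by (intro bexI [of _ c]) simp_all
  then have "int p \<in> set (map fst certs)"
    unfolding fst_certs [symmetric]
    by (simp only: set_concat set_map set_filter set_upto UN_iff image_image)
  then obtain t where t: "t \<in> set certs" "fst t = int p"
    by auto
  obtain j q v w where "t = (int p, j, q, v, w)"
    using t(2) by (cases t) auto
  then have "cert_ok (int p, j, q, v, w)"
    using certs_ok t(1) by (simp only: list_all_iff)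
  then show ?thesis
    by blast
qed

text \<open>The range of \<open>d\<close> suffices because \<open>s d \<le> 67\<close> with
  \<open>s\<close> at least 1.\<close>

lemma all_dead_67: "list_all (\<lambda>k. list_all (all_dead 67 k) [1..67]) [1, 2]"
  by code_simp

theorem theorem1p3:
  shows "\<forall>p::nat. prime p \<and> p < 2000 \<longrightarrow>
     ((\<not> (\<exists>\<xi>::real. \<xi> \<notin> \<rat> \<and> eventually_12 \<xi> \<and> eventually_12 (real p * \<xi>)))
      \<longleftrightarrow> p = 67)"
proof (intro allI impI iffI)
  fix p :: nat
  assume p: "prime p \<and> p < 2000"
    and none: "\<not> (\<exists>\<xi>::real. \<xi> \<notin> \<rat> \<and> eventually_12 \<xi> \<and> eventually_12 (real p * \<xi>))"
  show "p = 67"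
  proof (rule ccontr)
    assume "p \<noteq> 67"
    then obtain j q v w where "cert_ok (int p, j, q, v, w)"
      using prime_below_2000_cert p by blast
    then obtain \<xi> where "eventually_12 \<xi>" "eventually_12 (real p * \<xi>)"
      using cert_ok_sound by blast
    with none eventually_12_irrational show False
      by blast
  qed
next
  fix p :: nat
  assume "p = 67"
  moreover have "all_dead 67 k d" if "k \<in> {1, 2}" "d \<in> {1..67}" for k d
    using all_dead_67 that unfolding list_all_iff set_upto by auto
  ultimately show "\<not> (\<exists>\<xi>::real. \<xi> \<notin> \<rat> \<and> eventually_12 \<xi> \<and> eventually_12 (real p * \<xi>))"
    using no_eventually_12_multiple [of 67] by (metis of_nat_numeral zero_less_numeral)
qed

end
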